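(* Let $(\mathcal{A},\mu_k)$ be an $A_\infty$-algebra and $(\mathcal{M},\eta_k)$ an $A_\infty$-bimodule over it. If $(R,S)$ is a generalized Rota-Baxter system (a pair of degree $0$ linear maps $\mathcal{M}\to\mathcal{A}$ satisfying the identities in the context), then $(\mathcal{M},\mu_{k,[r]})$ is a $Dend_\infty$-algebra, where $$\mu_{k,[r]}(u_1,\dots,u_k)=\eta_k\big(R(u_1),\dots,R(u_{r-1}),u_r,S(u_{r+1}),\dots,S(u_k)\big),\quad k\ge1,\ 1\le r\le k.$$
   Context: All vector spaces are over a field $\mathbb{K}$ of characteristic zero; $|a|$ denotes the degree of $a$. $A_\infty$-algebra: a graded vector space $\mathcal{A}=\oplus\mathcal{A}_i$ with multilinear maps $\mu_k:\mathcal{A}^{\otimes k}\to\mathcal{A}$, $\deg\mu_k=k-2$, $k\ge1$, such that for all $n\ge1$ and homogeneous $a_1,\dots,a_n$, $$\sum_{i+j=n+1}\sum_{\lambda=1}^j(-1)^{\lambda(i+1)+i(|a_1|+\cdots+|a_{\lambda-1}|)}\mu_j\big(a_1,\dots,a_{\lambda-1},\mu_i(a_\lambda,\dots,a_{\lambda+i-1}),a_{\lambda+i},\dots,a_n\big)=0.$$ $A_\infty$-bimodule over $(\mathcal{A},\mu_k)$: a graded vector space $\mathcal{M}=\oplus\mathcal{M}_i$ with multilinear maps $\eta_k:\bigoplus_{i+1+j=k}\mathcal{A}^{\otimes i}\otimes\mathcal{M}\otimes\mathcal{A}^{\otimes j}\to\mathcal{M}$, $\deg\eta_k=k-2$, $k\ge1$,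 satisfying the same identities whenever exactly one of $a_1,\dots,a_n$ is in $\mathcal{M}$ and the others are in $\mathcal{A}$, each operation $\mu$ having an input in $\mathcal{M}$ being replaced by the corresponding $\eta$. Generalized Rota-Baxter system: degree $0$ linear maps $R,S:\mathcal{M}\to\mathcal{A}$ such that for all $k\ge1$ and $u_1,\dots,u_k\in\mathcal{M}$, \begin{align*} \mu_k(R(u_1),\dots,R(u_k))&=R\Big(\sum_{i=1}^k\eta_k(R(u_1),\dots,R(u_{i-1}),u_i,S(u_{i+1}),\dots,S(u_k))\Big),\\ \mu_k(S(u_1),\dots,S(u_k))&=S\Big(\sum_{i=1}^k\eta_k(R(u_1),\dots,R(u_{i-1}),u_i,S(u_{i+1}),\dots,S(u_k))\Big). \end{align*} $Dend_\infty$-algebra: let $C_n=\{[1],\dots,[n]\}$. For $m,n\ge 1$, $1\le i\le m$, with $n$ in the $i$-th place of $(1,\dots,n,\dots,1)$ (length $m$), define $R_0(m;1,\dots,n,\dots,1):C_{m+n-1}\to C_m$ and $R_i(m;1,\dots,n,\dots,1):C_{m+n-1}\to\mathbb{K}[C_n]$ by: if $1\le r\le i-1$, $R_0[r]=[r]$ and $R_i[r]=[1]+\cdots+[n]$; if $i\le r\le i+n-1$, $R_0[r]=[i]$ and $R_i[r]=[r-i+1]$; if $i+n\le r\le m+n-1$, $R_0[r]=[r-n+1]$ and $R_i[r]=[1]+\cdots+[n]$. A $Dend_\infty$-algebra is a graded vector space $\mathcal{D}$ with multilinear maps $\mu_{k,[r]}:\mathcal{D}^{\otimes k}\to\mathcal{D}$,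 $[r]\in C_k$, $\deg\mu_{k,[r]}=k-2$, $k\ge1$ (extended linearly in $[r]$ to $\mathbb{K}[C_k]$) such that for all $n\ge1$, $[r]\in C_n$ and homogeneous $a_1,\dots,a_n\in\mathcal{D}$, \begin{align*} \sum_{i+j=n+1}\sum_{\lambda=1}^j(-1)^{\lambda(i+1)+i(|a_1|+\cdots+|a_{\lambda-1}|)}\mu_{j,R_0(j;1,\dots,i,\dots,1)[r]}\big(a_1,\dots,a_{\lambda-1},\mu_{i,R_\lambda(j;1,\dots,i,\dots,1)[r]}(a_\lambda,\dots,a_{\lambda+i-1}),a_{\lambda+i},\dots,a_n\big)=0, \end{align*} where $i$ is in the $\lambda$-th place of $(1,\dots,i,\dots,1)$. *)

theory Defs
  imports Complex_Main "HOL-Library.Poly_Mapping"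
begin

locale graded_vector_space = vector_space scale
  for scale :: "'k::field_char_0 \<Rightarrow> 'v::ab_group_add \<Rightarrow> 'v" +
  fixes gr :: "int \<Rightarrow> 'v set"
  assumes subspace_gr: "subspace (gr d)"
    and direct_sum: "\<exists>!f. (\<forall>d. f d \<in> gr d) \<and> finite {d. f d \<noteq> 0} \<and> x = (\<Sum>d | f d \<noteq> 0. f d)"

text \<open>A multilinear map on a tensor power is a function on argument lists; only its values on
  lists of the length given by the arity are constrained or used.\<close>

definition multilinear ::
  "('k::field \<Rightarrow> 'v::ab_group_add \<Rightarrow> 'v) \<Rightarrow> ('k \<Rightarrow> 'w::ab_group_add \<Rightarrow> 'w) \<Rightarrow> nat \<Rightarrow> ('v list \<Rightarrow> 'w) \<Rightarrow> bool"
  where "multilinear sV sW k f \<longleftrightarrow>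
    (\<forall>xs p. length xs = k \<and> p < k \<longrightarrow> Vector_Spaces.linear sV sW (\<lambda>x. f (xs[p := x])))"

text \<open>The zero vector is homogeneous of every degree, so degrees are carried
  along as a separate list.\<close>

definition homogeneous :: "(int \<Rightarrow> 'v set) \<Rightarrow> 'v list \<Rightarrow> int list \<Rightarrow> bool"
  where "homogeneous gr xs ds \<longleftrightarrow> list_all2 (\<lambda>x d. x \<in> gr d) xs ds"

text \<open>The sign \<open>(-1)^(l(i+1) + i(|a_1| + ... + |a_(l-1)|))\<close>, where \<open>ds\<close> lists the degrees
  \<open>|a_1|, ..., |a_n|\<close>.\<close>

definition ainf_sign :: "nat \<Rightarrow> nat \<Rightarrow> int list \<Rightarrow> 'k::field"
  where "ainf_sign i l ds = (-1) powi (int l * (int i + 1) + int i * sum_list (take (l - 1) ds))"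

text \<open>The argument list \<open>a_1, ..., a_(l-1), f (a_l, ..., a_(l+i-1)), a_(l+i), ..., a_n\<close>,
  positions counted from 1.\<close>

definition insert_op :: "('v list \<Rightarrow> 'v) \<Rightarrow> nat \<Rightarrow> nat \<Rightarrow> 'v list \<Rightarrow> 'v list"
  where "insert_op f i l xs = take (l - 1) xs @ [f (take i (drop (l - 1) xs))] @ drop (l - 1 + i) xs"

locale A_inf_algebra = graded_vector_space scale gr
  for scale :: "'k::field_char_0 \<Rightarrow> 'a::ab_group_add \<Rightarrow> 'a" and gr :: "int \<Rightarrow> 'a set" +
  fixes \<mu> :: "nat \<Rightarrow> 'a list \<Rightarrow> 'a"
  assumes multilinear_mu: "k \<ge> 1 \<Longrightarrow> multilinear scale scale k (\<mu> k)"
    and degree_mu: "k \<ge> 1 \<Longrightarrow> length as = k \<Longrightarrow> homogeneous gr as ds \<Longrightarrow>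
      \<mu> k as \<in> gr (sum_list ds + int k - 2)"
    and A_inf_identity: "n \<ge> 1 \<Longrightarrow> length as = n \<Longrightarrow> homogeneous gr as ds \<Longrightarrow>
      (\<Sum>(i, j) | i \<ge> 1 \<and> j \<ge> 1 \<and> i + j = n + 1. \<Sum>l = 1..j.
        scale (ainf_sign i l ds) (\<mu> j (insert_op (\<mu> i) i l as))) = 0"

text \<open>The summand of the bimodule identity on the inputs \<open>as\<close>, \<open>m\<close>, \<open>bs\<close> (with \<open>m\<close> the one
  input from the bimodule) in which the inner operation is applied to the \<open>i\<close> inputs starting at
  position \<open>l\<close>. The cases are: the inner inputs all lie to the left of \<open>m\<close>, include \<open>m\<close>,
  or all lie to the right of \<open>m\<close>.\<close>

definition bimodule_term ::
  "(nat \<Rightarrow> 'a list \<Rightarrow> 'a) \<Rightarrow> (nat \<Rightarrow> 'a list \<Rightarrow> 'm \<Rightarrow> 'a list \<Rightarrow> 'm) \<Rightarrow>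
   nat \<Rightarrow> nat \<Rightarrow> nat \<Rightarrow> 'a list \<Rightarrow> 'm \<Rightarrow> 'a list \<Rightarrow> 'm"
  where "bimodule_term \<mu> \<eta> i j l as m bs =
    (let p = length as in
     if l + i - 1 \<le> p then \<eta> j (insert_op (\<mu> i) i l as) m bs
     else if l \<le> p + 1 then
       (let q = l + i - 1 - (p + 1) in
        \<eta> j (take (l - 1) as) (\<eta> i (drop (l - 1) as) m (take q bs)) (drop q bs))
     else \<eta> j as m (insert_op (\<mu> i) i (l - (p + 1)) bs))"

text \<open>The operation \<open>\<eta> k\<close> is given by its components on \<open>A^i \<otimes> M \<otimes> A^j\<close> with
  \<open>i + 1 + j = k\<close>; the numbers \<open>i\<close> and \<open>j\<close> are the lengths of its two list arguments.\<close>

locale A_inf_bimodule = A_inf_algebra scaleA grA \<mu> + M: graded_vector_space scaleM grM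
  for scaleA :: "'k::field_char_0 \<Rightarrow> 'a::ab_group_add \<Rightarrow> 'a" and grA :: "int \<Rightarrow> 'a set"
    and \<mu> :: "nat \<Rightarrow> 'a list \<Rightarrow> 'a"
    and scaleM :: "'k \<Rightarrow> 'm::ab_group_add \<Rightarrow> 'm" and grM :: "int \<Rightarrow> 'm set" +
  fixes \<eta> :: "nat \<Rightarrow> 'a list \<Rightarrow> 'm \<Rightarrow> 'a list \<Rightarrow> 'm"
  assumes linear_eta: "k = length as + 1 + length bs \<Longrightarrow>
      Vector_Spaces.linear scaleM scaleM (\<lambda>m. \<eta> k as m bs)"
    and multilinear_eta_left: "k = i + 1 + length bs \<Longrightarrow>
      multilinear scaleA scaleM i (\<lambda>as. \<eta> k as m bs)"
    and multilinear_eta_right: "k = length as + 1 + j \<Longrightarrow>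
      multilinear scaleA scaleM j (\<lambda>bs. \<eta> k as m bs)"
    and degree_eta: "k = length as + 1 + length bs \<Longrightarrow>
      homogeneous grA as ds \<Longrightarrow> m \<in> grM d \<Longrightarrow> homogeneous grA bs es \<Longrightarrow>
      \<eta> k as m bs \<in> grM (sum_list ds + d + sum_list es + int k - 2)"
    and bimodule_identity: "n = length as + 1 + length bs \<Longrightarrow>
      homogeneous grA as ds \<Longrightarrow> m \<in> grM d \<Longrightarrow> homogeneous grA bs es \<Longrightarrow>
      (\<Sum>(i, j) | i \<ge> 1 \<and> j \<ge> 1 \<and> i + j = n + 1. \<Sum>l = 1..j.
        scaleM (ainf_sign i l (ds @ [d] @ es)) (bimodule_term \<mu> \<eta> i j l as m bs)) = 0"

text \<open>\<open>\<eta>_k (R u_1, ..., R u_(r-1), u_r, S u_(r+1), ..., S u_k)\<close>\<close>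

definition eta_RS ::
  "(nat \<Rightarrow> 'a list \<Rightarrow> 'm \<Rightarrow> 'a list \<Rightarrow> 'm) \<Rightarrow> ('m \<Rightarrow> 'a) \<Rightarrow> ('m \<Rightarrow> 'a) \<Rightarrow> nat \<Rightarrow> nat \<Rightarrow> 'm list \<Rightarrow> 'm"
  where "eta_RS \<eta> R S k r us = \<eta> k (map R (take (r - 1) us)) (us ! (r - 1)) (map S (drop r us))"

definition generalized_Rota_Baxter_system ::
  "('k::field_char_0 \<Rightarrow> 'a::ab_group_add \<Rightarrow> 'a) \<Rightarrow> (int \<Rightarrow> 'a set) \<Rightarrow> (nat \<Rightarrow> 'a list \<Rightarrow> 'a) \<Rightarrow>
   ('k \<Rightarrow> 'm::ab_group_add \<Rightarrow> 'm) \<Rightarrow> (int \<Rightarrow> 'm set) \<Rightarrow>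
   (nat \<Rightarrow> 'a list \<Rightarrow> 'm \<Rightarrow> 'a list \<Rightarrow> 'm) \<Rightarrow> ('m \<Rightarrow> 'a) \<Rightarrow> ('m \<Rightarrow> 'a) \<Rightarrow> bool"
  where "generalized_Rota_Baxter_system scaleA grA \<mu> scaleM grM \<eta> R S \<longleftrightarrow>
    Vector_Spaces.linear scaleM scaleA R \<and> (\<forall>d. R ` grM d \<subseteq> grA d) \<and>
    Vector_Spaces.linear scaleM scaleA S \<and> (\<forall>d. S ` grM d \<subseteq> grA d) \<and>
    (\<forall>k us. k \<ge> 1 \<and> length us = k \<longrightarrow>
      \<mu> k (map R us) = R (\<Sum>i = 1..k. eta_RS \<eta> R S k i us) \<and>
      \<mu> k (map S us) = S (\<Sum>i = 1..k. eta_RS \<eta> R S k i us))"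

text \<open>The element \<open>[r]\<close> of \<open>C_n\<close> is the number \<open>r\<close> with \<open>1 \<le> r \<le> n\<close>, and elements of
  \<open>K[C_n]\<close> are finitely supported functions \<open>nat \<Rightarrow>\<^sub>0 'k\<close>. The map \<open>R_0(m; 1, ..., n, ..., 1)\<close>
  with \<open>n\<close> in the \<open>i\<close>-th place is \<open>dend_R0 i n\<close>, and \<open>R_i(m; 1, ..., n, ..., 1)\<close> is
  \<open>dend_R i n\<close>; the number \<open>m\<close> only enters through the domain \<open>{1..m + n - 1}\<close> of \<open>r\<close>.\<close>

definition dend_R0 :: "nat \<Rightarrow> nat \<Rightarrow> nat \<Rightarrow> nat"
  where "dend_R0 i n r =
    (if r \<le> i - 1 then r else if r \<le> i + n - 1 then i else r - n + 1)"

definition dend_R :: "nat \<Rightarrow> nat \<Rightarrow> nat \<Rightarrow> (nat \<Rightarrow>\<^sub>0 'k::field)"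
  where "dend_R i n r =
    (if i \<le> r \<and> r \<le> i + n - 1 then Poly_Mapping.single (r - i + 1) 1
     else (\<Sum>s = 1..n. Poly_Mapping.single s 1))"

text \<open>The linear extension of \<open>[r] \<mapsto> \<mu>_(k,[r])\<close> to \<open>K[C_k]\<close>\<close>

definition linear_ext ::
  "('k::field \<Rightarrow> 'v::ab_group_add \<Rightarrow> 'v) \<Rightarrow> (nat \<Rightarrow> nat \<Rightarrow> 'v list \<Rightarrow> 'v) \<Rightarrow>
   nat \<Rightarrow> (nat \<Rightarrow>\<^sub>0 'k) \<Rightarrow> 'v list \<Rightarrow> 'v"
  where "linear_ext scale \<mu> k c xs = (\<Sum>s = 1..k. scale (Poly_Mapping.lookup c s) (\<mu> k s xs))"

locale Dend_inf_algebra = graded_vector_space scale gr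
  for scale :: "'k::field_char_0 \<Rightarrow> 'v::ab_group_add \<Rightarrow> 'v" and gr :: "int \<Rightarrow> 'v set" +
  fixes \<mu> :: "nat \<Rightarrow> nat \<Rightarrow> 'v list \<Rightarrow> 'v"
  assumes multilinear_mu: "k \<ge> 1 \<Longrightarrow> r \<in> {1..k} \<Longrightarrow> multilinear scale scale k (\<mu> k r)"
    and degree_mu: "k \<ge> 1 \<Longrightarrow> r \<in> {1..k} \<Longrightarrow> length as = k \<Longrightarrow> homogeneous gr as ds \<Longrightarrow>
      \<mu> k r as \<in> gr (sum_list ds + int k - 2)"
    and Dend_inf_identity: "n \<ge> 1 \<Longrightarrow> r \<in> {1..n} \<Longrightarrow> length as = n \<Longrightarrow> homogeneous gr as ds \<Longrightarrow>
      (\<Sum>(i, j) | i \<ge> 1 \<and> j \<ge> 1 \<and> i + j = n + 1. \<Sum>l = 1..j.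
        scale (ainf_sign i l ds)
          (\<mu> j (dend_R0 l i r) (insert_op (linear_ext scale \<mu> i (dend_R l i r)) i l as))) = 0"

end

(* For the inputs R(u_1), ..., R(u_{r-1}), u_r, S(u_{r+1}), ..., S(u_n), the bimodule identity and
   the identity indexed by [r] agree summand by summand. If the inner operation acts on u_r, both
   summands involve the same composite of two eta's. If it acts only on entries to the left
   (right) of u_r, the inner mu is applied to values of R (of S), and the Rota-Baxter identity
   turns it into R (S) of the sum of all mu_{i,[s]}, which is the operation with index
   [1] + ... + [i] that the Dend-infinity identity prescribes there. *)

theory Submission
  imports Defs
begin

text \<open>Positions are handled by cutting the list explicitly, so that the truncated
  \<open>l - 1\<close> in \<open>insert_op\<close> disappears and the remaining work is comparing
  concatenations.\<close>

lemma insert_op_append: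
  assumes "length xs + 1 = l" and "length ys = i"
  shows "insert_op f i l (xs @ ys @ zs) = xs @ f ys # zs"
  using assms by (auto simp: insert_op_def)

lemma eta_RS_append_Cons:
  assumes "length xs + 1 = r"
  shows "eta_RS \<eta> R S k r (xs @ u # ys) = \<eta> k (map R xs) u (map S ys)"
  using assms by (auto simp: eta_RS_def)

lemma homogeneous_append_Cons_E:
  assumes "homogeneous gr (xs @ u # ys) ds"
  obtains ds1 d ds2 where "ds = ds1 @ [d] @ ds2"
    "homogeneous gr xs ds1" "u \<in> gr d" "homogeneous gr ys ds2"
  using assms by (auto simp: homogeneous_def list_all2_append1 list_all2_Cons1)

lemma homogeneous_map:
  assumes "homogeneous gr xs ds" and "\<And>d. f ` gr d \<subseteq> gr' d"
  shows "homogeneous gr' (map f xs) ds"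
  using assms by (fastforce simp: homogeneous_def list_all2_conv_all_nth)

text \<open>Updating an entry commutes with \<open>map g\<close>, so each one-slot map is the
  corresponding slot map of \<open>f\<close> composed with \<open>g\<close>. This carries
  multilinearity of \<open>\<eta>\<close> through \<open>R\<close> and \<open>S\<close>.\<close>

lemma multilinear_compose_map:
  fixes g :: "'v::ab_group_add \<Rightarrow> 'w::ab_group_add"
  assumes f: "multilinear sW sX k f" and g: "Vector_Spaces.linear sV sW g"
  shows "multilinear sV sX k (\<lambda>xs. f (map g xs))"
  unfolding multilinear_def
proof (intro allI impI)
  fix xs :: "'v list" and p
  assume "length xs = k \<and> p < k"
  then have "Vector_Spaces.linear sW sX (\<lambda>x. f ((map g xs)[p := x]))"
    using f by (simp add: multilinear_def)
  from Vector_Spaces.linear_compose[OF g this]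
  show "Vector_Spaces.linear sV sX (\<lambda>x. f (map g (xs[p := x])))"
    by (simp add: o_def map_update)
qed

lemma split_at_index:
  assumes "r \<in> {1..length us}"
  obtains xs u ys where "us = xs @ u # ys" "length xs + 1 = r"
proof
  show "us = take (r - 1) us @ us ! (r - 1) # drop r us"
    using assms id_take_nth_drop[of "r - 1" us] by force
  show "length (take (r - 1) us) + 1 = r"
    using assms by auto
qed

lemma split_at_block:
  assumes "l \<ge> 1" and "l + i \<le> length us + 1"
  obtains xs ys zs where "us = xs @ ys @ zs" "length xs + 1 = l" "length ys = i"
proof -
  have "us = take (l - 1) us @ take i (drop (l - 1) us) @ drop i (drop (l - 1) us)"
    by (simp only: append_take_drop_id)
  moreover have "length (take (l - 1) us) + 1 = l" "length (take i (drop (l - 1) us)) = i"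
    using assms by auto
  ultimately show ?thesis by (rule that)
qed

context A_inf_bimodule
begin

lemma eta_RS_multilinear:
  assumes R: "Vector_Spaces.linear scaleM scaleA R" and S: "Vector_Spaces.linear scaleM scaleA S"
    and r: "r \<in> {1..k}"
  shows "multilinear scaleM scaleM k (eta_RS \<eta> R S k r)"
  unfolding multilinear_def
proof (intro allI impI)
  fix us :: "'m list" and p
  assume *: "length us = k \<and> p < k"
  with r obtain xs u ys where us: "us = xs @ u # ys" and xs: "length xs + 1 = r"
    using split_at_index by metis
  with * have k: "k = length xs + 1 + length ys" by simp
  \<comment> \<open>The varied entry passes through \<open>R\<close>, is the bimodule input, or
    passes through \<open>S\<close>; each case rests on its own linearity axiom for
    \<open>\<eta>\<close>.\<close>
  consider "p < length xs" | "p = length xs" | q where "p = length xs + 1 + q" "q < length ys"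
    using * k that(3)[of "p - (length xs + 1)"] by linarith
  then show "Vector_Spaces.linear scaleM scaleM (\<lambda>x. eta_RS \<eta> R S k r (us[p := x]))"
  proof cases
    case 1
    then have "eta_RS \<eta> R S k r (us[p := x]) = \<eta> k (map R (xs[p := x])) u (map S ys)" for x
      using xs by (simp add: us list_update_append eta_RS_append_Cons)
    moreover have "multilinear scaleM scaleM (length xs) (\<lambda>xs. \<eta> k (map R xs) u (map S ys))"
      using k by (intro multilinear_compose_map[OF multilinear_eta_left R]) simp
    ultimately show ?thesis using 1 by (simp add: multilinear_def)
  next
    case 2
    then have "eta_RS \<eta> R S k r (us[p := x]) = \<eta> k (map R xs) x (map S ys)" for x
      using xs by (simp add: us eta_RS_append_Cons)
    then show ?thesis using k linear_eta[of k "map R xs" "map S ys"] by simp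
  next
    case 3
    then have "eta_RS \<eta> R S k r (us[p := x]) = \<eta> k (map R xs) u (map S (ys[q := x]))" for x
      using xs by (simp add: us list_update_append eta_RS_append_Cons)
    moreover have "multilinear scaleM scaleM (length ys) (\<lambda>ys. \<eta> k (map R xs) u (map S ys))"
      using k by (intro multilinear_compose_map[OF multilinear_eta_right S]) simp
    ultimately show ?thesis using 3 by (simp add: multilinear_def)
  qed
qed

text \<open>As \<open>R\<close> and \<open>S\<close> have degree 0, the degrees of \<open>us\<close>
  also serve as degrees of the inputs of \<open>\<eta>\<close>.\<close>

lemma eta_RS_degree:
  assumes R: "\<And>d. R ` grM d \<subseteq> grA d" and S: "\<And>d. S ` grM d \<subseteq> grA d"
    and r: "r \<in> {1..k}" and us: "length us = k" "homogeneous grM us ds"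
  shows "eta_RS \<eta> R S k r us \<in> grM (sum_list ds + int k - 2)"
proof -
  obtain xs u ys where split: "us = xs @ u # ys" "length xs + 1 = r"
    using r us split_at_index by metis
  then obtain ds1 d ds2 where ds: "ds = ds1 @ [d] @ ds2"
    and "homogeneous grM xs ds1" "u \<in> grM d" "homogeneous grM ys ds2"
    using us homogeneous_append_Cons_E by metis
  then have "\<eta> k (map R xs) u (map S ys) \<in> grM (sum_list ds1 + d + sum_list ds2 + int k - 2)"
    using us(1) split homogeneous_map[OF _ R] homogeneous_map[OF _ S] by (intro degree_eta) simp_all
  with split ds show ?thesis by (simp add: eta_RS_append_Cons add.assoc)
qed

lemma linear_ext_dend_R_inside:
  assumes "l \<le> r" and "r < l + i"
  shows "linear_ext scaleM \<nu> i (dend_R l i r) us = \<nu> i (r - l + 1) us"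
proof -
  have "linear_ext scaleM \<nu> i (dend_R l i r) us =
      (\<Sum>t = 1..i. if r - l + 1 = t then \<nu> i t us else 0)"
    unfolding linear_ext_def
    using assms by (intro sum.cong) (auto simp: dend_R_def lookup_single when_def)
  \<comment> \<open>The index singled out lies in the summation range, so the sum collapses to its
    one nonzero term.\<close>
  moreover have "r - l + 1 \<in> {1..i}" using assms by simp
  ultimately show ?thesis by simp
qed

lemma linear_ext_dend_R_outside:
  assumes "r < l \<or> l + i \<le> r" and "i \<ge> 1"
  shows "linear_ext scaleM \<nu> i (dend_R l i r) us = (\<Sum>s = 1..i. \<nu> i s us)"
proof -
  have "\<not> (l \<le> r \<and> r \<le> l + i - 1)" using assms by linarith
  then show ?thesis
    unfolding linear_ext_def dend_R_def
    by (intro sum.cong) (auto simp: lookup_sum lookup_single when_def)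
qed

text \<open>A comparison of argument lists for one fixed block: signs and degrees do not enter, and
  \<open>j\<close> is merely passed on to the outer \<open>\<eta>\<close>.\<close>

lemma dend_term_eq_bimodule_term:
  assumes RB: "\<And>vs. length vs = i \<Longrightarrow> \<mu> i (map R vs) = R (\<Sum>s = 1..i. eta_RS \<eta> R S i s vs)"
      "\<And>vs. length vs = i \<Longrightarrow> \<mu> i (map S vs) = S (\<Sum>s = 1..i. eta_RS \<eta> R S i s vs)"
    and us: "us = xs @ u # ys" "length xs + 1 = r"
    and i: "i \<ge> 1" and l: "l \<ge> 1" "l + i \<le> length us + 1"
  shows "eta_RS \<eta> R S j (dend_R0 l i r)
      (insert_op (linear_ext scaleM (eta_RS \<eta> R S) i (dend_R l i r)) i l us)
    = bimodule_term \<mu> \<eta> i j l (map R xs) u (map S ys)"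
proof -
  \<comment> \<open>Since \<open>u\<close> has position \<open>r\<close>, the block
    \<open>l, ..., l + i - 1\<close> ends before \<open>u\<close>, contains it, or starts after
    it.\<close>
  consider "l + i \<le> r" | "l \<le> r" "r < l + i" | "r < l" by linarith
  then show ?thesis
  proof cases
    case 1
    then obtain as bs cs where xs: "xs = as @ bs @ cs" "length as + 1 = l" "length bs = i"
      using split_at_block[of l i xs] us l by auto
    have "us = as @ bs @ cs @ u # ys" using us xs by simp
    then have "insert_op f i l us = (as @ f bs # cs) @ u # ys" for f
      using xs by (simp add: insert_op_append)
    \<comment> \<open>The block of \<open>i\<close> entries shrinks to one, moving \<open>u\<close>
      to position \<open>r - i + 1\<close>. The variable \<open>v\<close> stands for the contracted
      value, which does not affect the length.\<close>
    moreover have "dend_R0 l i r = length (as @ v # cs) + 1" for v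
      using 1 i l us xs by (auto simp: dend_R0_def)
    moreover have "insert_op (\<mu> i) i l (map R xs) = map R as @ \<mu> i (map R bs) # map R cs"
      using xs by (simp add: insert_op_append)
    moreover have "l + i - 1 \<le> length xs" using 1 us by simp
    ultimately show ?thesis using 1 i xs
      by (simp add: eta_RS_append_Cons bimodule_term_def linear_ext_dend_R_outside RB(1)
        del: append_assoc append_Cons)
  next
    case 2
    \<comment> \<open>The block is \<open>bs @ u # cs\<close>: \<open>u\<close> is its entry number
      \<open>r - l + 1\<close>, and \<open>l + i - 1 - r\<close> entries follow \<open>u\<close>,
      which is the \<open>q\<close> of \<open>bimodule_term\<close>. The inner value then becomes
      the bimodule input of the outer operation, at position \<open>l\<close>.\<close>
    define as bs where "as = take (l - 1) xs" and "bs = drop (l - 1) xs"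
    define cs ds where "cs = take (l + i - 1 - r) ys" and "ds = drop (l + i - 1 - r) ys"
    have len: "length as + 1 = l" "length bs + 1 = r - l + 1" "length (bs @ u # cs) = i"
      using 2 us l by (auto simp: as_def bs_def cs_def)
    have "us = as @ (bs @ u # cs) @ ds" using us by (simp add: as_def bs_def cs_def ds_def)
    then have "insert_op f i l us = as @ f (bs @ u # cs) # ds" for f
      using len by (simp add: insert_op_append del: append_assoc append_Cons length_append)
    moreover have "dend_R0 l i r = l" using 2 l by (auto simp: dend_R0_def)
    moreover have "bimodule_term \<mu> \<eta> i j l (map R xs) u (map S ys) =
        \<eta> j (map R as) (\<eta> i (map R bs) u (map S cs)) (map S ds)"
      using 2 us by (auto simp: bimodule_term_def Let_def as_def bs_def cs_def ds_def take_map drop_map)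
    ultimately show ?thesis using len
      by (simp add: eta_RS_append_Cons linear_ext_dend_R_inside 2)
  next
    case 3
    \<comment> \<open>The first \<open>r\<close> entries are \<open>xs\<close> and \<open>u\<close>,
      so the block starts at position \<open>l - r\<close> of \<open>ys\<close>.\<close>
    then have "l - r \<ge> 1" "l - r + i \<le> length ys + 1" using us l by simp_all
    then obtain as bs cs where ys: "ys = as @ bs @ cs" "length as + 1 = l - r" "length bs = i"
      using split_at_block by metis
    have "us = (xs @ u # as) @ bs @ cs" using us ys by simp
    moreover have "length (xs @ u # as) + 1 = l" using us ys 3 by simp
    ultimately have "insert_op f i l us = xs @ u # as @ f bs # cs" for f
      using ys by (simp only: insert_op_append) simp
    moreover have "dend_R0 l i r = r" using 3 by (auto simp: dend_R0_def)
    moreover have "insert_op (\<mu> i) i (l - r) (map S ys) = map S as @ \<mu> i (map S bs) # map S cs"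
      using ys by (simp add: insert_op_append)
    moreover have "bimodule_term \<mu> \<eta> i j l (map R xs) u (map S ys) =
        \<eta> j (map R xs) u (insert_op (\<mu> i) i (l - r) (map S ys))"
      using 3 us i by (auto simp: bimodule_term_def Let_def)
    ultimately show ?thesis using 3 i us ys
      by (simp add: eta_RS_append_Cons linear_ext_dend_R_outside RB(2))
  qed
qed

end

theorem theorem6p5:
  fixes scaleA :: "'k::field_char_0 \<Rightarrow> 'a::ab_group_add \<Rightarrow> 'a" and grA :: "int \<Rightarrow> 'a set"
    and \<mu> :: "nat \<Rightarrow> 'a list \<Rightarrow> 'a"
    and scaleM :: "'k \<Rightarrow> 'm::ab_group_add \<Rightarrow> 'm" and grM :: "int \<Rightarrow> 'm set"
    and \<eta> :: "nat \<Rightarrow> 'a list \<Rightarrow> 'm \<Rightarrow> 'a list \<Rightarrow> 'm"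
    and R S :: "'m \<Rightarrow> 'a"
  assumes "A_inf_algebra scaleA grA \<mu>"
    and "A_inf_bimodule scaleA grA \<mu> scaleM grM \<eta>"
    and "generalized_Rota_Baxter_system scaleA grA \<mu> scaleM grM \<eta> R S"
  shows "Dend_inf_algebra scaleM grM
    (\<lambda>k r us. \<eta> k (map R (take (r - 1) us)) (us ! (r - 1)) (map S (drop r us)))"
proof -
  interpret A_inf_bimodule scaleA grA \<mu> scaleM grM \<eta> by fact
  have R: "Vector_Spaces.linear scaleM scaleA R" "\<And>d. R ` grM d \<subseteq> grA d"
    and S: "Vector_Spaces.linear scaleM scaleA S" "\<And>d. S ` grM d \<subseteq> grA d"
    and RB: "\<And>k us. k \<ge> 1 \<Longrightarrow> length us = k \<Longrightarrow>
        \<mu> k (map R us) = R (\<Sum>i = 1..k. eta_RS \<eta> R S k i us)"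
      "\<And>k us. k \<ge> 1 \<Longrightarrow> length us = k \<Longrightarrow>
        \<mu> k (map S us) = S (\<Sum>i = 1..k. eta_RS \<eta> R S k i us)"
    using assms(3) unfolding generalized_Rota_Baxter_system_def by blast+
  have "Dend_inf_algebra scaleM grM (eta_RS \<eta> R S)"
  proof unfold_locales
    show "multilinear scaleM scaleM k (eta_RS \<eta> R S k r)" if "r \<in> {1..k}" for k r
      using eta_RS_multilinear[OF R(1) S(1) that] .
    show "eta_RS \<eta> R S k r us \<in> grM (sum_list ds + int k - 2)"
      if "r \<in> {1..k}" "length us = k" "homogeneous grM us ds" for k r us ds
      using eta_RS_degree[OF R(2) S(2) that] .
  next
    fix n r us ds
    assume r: "r \<in> {1..n}" and n: "length us = n" and us: "homogeneous grM us ds"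
    obtain xs u ys where split: "us = xs @ u # ys" "length xs + 1 = r"
      using r n split_at_index by metis
    then obtain ds1 d ds2 where ds: "ds = ds1 @ [d] @ ds2"
      and hom: "homogeneous grM xs ds1" "u \<in> grM d" "homogeneous grM ys ds2"
      using us homogeneous_append_Cons_E by metis
    \<comment> \<open>Both sides carry the same signs, computed from \<open>ds\<close>. In each
      summand \<open>l \<le> j\<close> and \<open>i + j = n + 1\<close> give
      \<open>l + i \<le> n + 1\<close>, so the block fits into \<open>us\<close>.\<close>
    have "(\<Sum>(i, j) | i \<ge> 1 \<and> j \<ge> 1 \<and> i + j = n + 1. \<Sum>l = 1..j. scaleM (ainf_sign i l ds)
        (eta_RS \<eta> R S j (dend_R0 l i r)
          (insert_op (linear_ext scaleM (eta_RS \<eta> R S) i (dend_R l i r)) i l us))) =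
      (\<Sum>(i, j) | i \<ge> 1 \<and> j \<ge> 1 \<and> i + j = n + 1. \<Sum>l = 1..j.
        scaleM (ainf_sign i l ds) (bimodule_term \<mu> \<eta> i j l (map R xs) u (map S ys)))"
      by (auto intro!: sum.cong arg_cong[where f = "scaleM _"]
        dend_term_eq_bimodule_term[OF RB split] simp: n)
    also have "\<dots> = 0"
      \<comment> \<open>Cutting \<open>ds\<close> at \<open>u\<close> gives the form in
        \<open>bimodule_identity\<close>; the outer pieces are degrees of the images under
        \<open>R\<close> and \<open>S\<close> too.\<close>
      unfolding ds
      using split n by (intro bimodule_identity homogeneous_map[OF hom(1) R(2)] hom(2)
        homogeneous_map[OF hom(3) S(2)]) simp
    finally show "(\<Sum>(i, j) | i \<ge> 1 \<and> j \<ge> 1 \<and> i + j = n + 1. \<Sum>l = 1..j.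
      scaleM (ainf_sign i l ds) (eta_RS \<eta> R S j (dend_R0 l i r)
        (insert_op (linear_ext scaleM (eta_RS \<eta> R S) i (dend_R l i r)) i l us))) = 0" .
  qed
  then show ?thesis by (simp only: eta_RS_def[abs_def])
qed

end
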